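(* Let $G=(V,E)$ be a simple, undirected, connected graph on $n\ge 2$ vertices with adjacency eigenvalues $\lambda_1 \ge \dots \ge \lambda_n$ and normalized Perron eigenvector $\nu$. Let $\lambda = \max\{|\lambda_2|,|\lambda_n|\}$. Then for any subsets $S,T\subseteq V$, $$\big| e(S,T) - \lambda_1 \langle \chi_S,\nu \rangle\langle\chi_T,\nu\rangle \big| \leq \lambda \sqrt{(|S| - \langle\chi_S,\nu\rangle^2)(|T| - \langle\chi_T,\nu\rangle^2)}.$$
   Context: The adjacency eigenvalues are the eigenvalues (with multiplicity) of the adjacency matrix $A$ of $G$. The normalized Perron eigenvector $\nu=(\nu_v)_{v\in V}$ is the unique eigenvector of $A$ for $\lambda_1$ with all entries positive and Euclidean norm $\|\nu\|=1$. $\chi_S\in\{0,1\}^V$ is the characteristic vector of $S$. $e(S,T)$ is the number of edges between $S$ and $T$, where edges with both endpoints in $S\cap T$ are counted twice, i.e. $e(S,T)=\chi_S^\top A\chi_T$. *)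

theory Defs
  imports "HOL-Analysis.Analysis" "HOL-Computational_Algebra.Polynomial" "HOL-Library.Multiset"
begin

text \<open>
  The vertex set is the whole finite type \<open>'v\<close>; a simple undirected graph is given by its set of
  edges, each edge being a two-element set of vertices.
\<close>

definition simple_graph :: "'v set set \<Rightarrow> bool" where
  "simple_graph E \<longleftrightarrow> (\<forall>e\<in>E. card e = 2)"

definition connected_graph :: "'v set set \<Rightarrow> bool" where
  "connected_graph E \<longleftrightarrow> (\<forall>u v. (u, v) \<in> {(x, y). {x, y} \<in> E}\<^sup>*)"

definition adj_matrix :: "'v::finite set set \<Rightarrow> real ^ 'v ^ 'v" where
  "adj_matrix E = (\<chi> u v. if {u, v} \<in> E then 1 else 0)"

definition charpoly :: "'a::comm_ring_1 ^ 'n ^ 'n \<Rightarrow> 'a poly" where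
  "charpoly A = det (mat [:0, 1:] - map_matrix (\<lambda>a. [:a:]) A)"

text \<open>
  The real eigenvalues of a matrix, repeated according to algebraic multiplicity, in
  non-increasing order. For a symmetric matrix this list has length \<open>CARD('n)\<close>.
\<close>

definition eigenvalue_list :: "real ^ 'n ^ 'n \<Rightarrow> real list" where
  "eigenvalue_list A = rev (sorted_list_of_multiset (proots (charpoly A)))"

text \<open>Eigenvalues are numbered from 1, whereas list positions start at 0.\<close>

definition adj_eigenvalue :: "'v::finite set set \<Rightarrow> nat \<Rightarrow> real" where
  "adj_eigenvalue E i = eigenvalue_list (adj_matrix E) ! (i - 1)"

text \<open>For a connected graph, Perron--Frobenius yields exactly one such vector.\<close>

definition normalized_perron_vector :: "'v::finite set set \<Rightarrow> real ^ 'v \<Rightarrow> bool" where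
  "normalized_perron_vector E \<nu> \<longleftrightarrow>
     adj_matrix E *v \<nu> = adj_eigenvalue E 1 *\<^sub>R \<nu> \<and> (\<forall>v. 0 < \<nu> $ v) \<and> norm \<nu> = 1"

definition char_vec :: "'v::finite set \<Rightarrow> real ^ 'v" where
  "char_vec S = (\<chi> v. if v \<in> S then 1 else 0)"

text \<open>The second summand counts the edges inside \<open>S \<inter> T\<close> a second time.\<close>

definition edges_between :: "'v set set \<Rightarrow> 'v set \<Rightarrow> 'v set \<Rightarrow> nat" where
  "edges_between E S T =
     card {e \<in> E. \<exists>s\<in>S. \<exists>t\<in>T. e = {s, t}} + card {e \<in> E. e \<subseteq> S \<inter> T}"

lemma card_edge_pairs:
  fixes E :: "'v::finite set set"
  assumes "simple_graph E"
  shows "card {(s, t). s \<in> S \<and> t \<in> T \<and> {s, t} \<in> E} = edges_between E S T"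
proof -
  let ?P = "{(s, t). s \<in> S \<and> t \<in> T \<and> {s, t} \<in> E}"
  let ?B = "{e \<in> E. \<exists>s\<in>S. \<exists>t\<in>T. e = {s, t}}"
  let ?C = "{e \<in> E. e \<subseteq> S \<inter> T}"
  let ?F = "\<lambda>e. {(s, t). s \<in> S \<and> t \<in> T \<and> {s, t} = e}"
  have fibre: "card (?F e) = 1 + (if e \<in> ?C then 1 else 0)" if e: "e \<in> ?B" for e
  proof -
    from e obtain s t where st: "e \<in> E" "s \<in> S" "t \<in> T" "e = {s, t}" by blast
    have "card e = 2" using assms st(1) by (simp add: simple_graph_def)
    then have ne: "s \<noteq> t" using st(4) by auto
    show ?thesis
    proof (cases "e \<in> ?C")
      case True
      then have "?F e = {(s, t), (t, s)}" using st by (auto simp: doubleton_eq_iff)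
      then show ?thesis using True ne by simp
    next
      case False
      then have "?F e = {(s, t)}" using st by (auto simp: doubleton_eq_iff)
      then show ?thesis using False by simp
    qed
  qed
  have "?C \<subseteq> ?B"
  proof
    fix e assume e: "e \<in> ?C"
    then have "card e = 2" using assms by (simp add: simple_graph_def)
    then obtain s t where "e = {s, t}" by (auto simp: card_2_iff)
    then show "e \<in> ?B" using e by auto
  qed
  then have C: "?B \<inter> ?C = ?C" by blast
  have "card ?P = card (\<Union>e\<in>?B. ?F e)" by (rule arg_cong[where f = card]) auto
  also have "\<dots> = (\<Sum>e\<in>?B. card (?F e))" by (rule card_UN_disjoint) auto
  also have "\<dots> = (\<Sum>e\<in>?B. 1 + (if e \<in> ?C then 1 else 0))"
    using fibre by (rule sum.cong[OF refl])
  also have "\<dots> = card ?B + card (?B \<inter> ?C)"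
    by (simp only: sum.distrib sum.inter_restrict[symmetric] finite card_eq_sum)
  finally show ?thesis unfolding C edges_between_def .
qed

lemma edges_between_eq_inner:
  fixes E :: "'v::finite set set"
  assumes "simple_graph E"
  shows "real (edges_between E S T) = char_vec S \<bullet> (adj_matrix E *v char_vec T)"
proof -
  let ?P = "{(s, t). s \<in> S \<and> t \<in> T \<and> {s, t} \<in> E}"
  have "char_vec S \<bullet> (adj_matrix E *v char_vec T) =
      (\<Sum>s\<in>UNIV. \<Sum>t\<in>UNIV. if (s, t) \<in> ?P then 1 else 0)"
    unfolding inner_vec_def matrix_vector_mult_def char_vec_def adj_matrix_def
    by (auto simp: sum_distrib_left intro!: sum.cong)
  also have "\<dots> = (\<Sum>p\<in>UNIV. if p \<in> ?P then 1 else 0)"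
    by (simp add: sum.cartesian_product split_def)
  also have "\<dots> = real (card ?P)"
    by (simp add: sum.If_cases)
  finally show ?thesis using card_edge_pairs[OF assms] by simp
qed

end

theory Submission
  imports Defs
begin

text \<open>
  Extend \<open>\<nu>\<close> to an orthonormal eigenbasis of the adjacency matrix \<open>A\<close>. Together with \<open>\<lambda>\<^sub>1\<close>, the
  eigenvalues of the remaining basis vectors make up the whole spectrum, so they are
  \<open>\<lambda>\<^sub>2, \<dots>, \<lambda>\<^sub>n\<close>, and \<open>A\<close> has operator norm at most \<open>\<lambda>\<close> on the orthogonal complement of
  \<open>\<nu>\<close>. Projecting \<open>\<chi>\<^sub>S\<close> and \<open>\<chi>\<^sub>T\<close> to this complement, the claim becomes the Cauchy--Schwarz
  inequality.
\<close>

section \<open>Spectral theorem for real symmetric matrices\<close>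

lemma inner_matrix_vector_mult_symmetric:
  fixes A :: "real ^ 'n ^ 'n"
  assumes "transpose A = A"
  shows "x \<bullet> (A *v y) = (A *v x) \<bullet> y"
  using assms by (metis dot_lmul_matrix transpose_matrix_vector)

text \<open>The Rayleigh quotient attains its maximum on the unit sphere of \<open>W\<close> at an eigenvector.\<close>

lemma symmetric_matrix_eigenvector_in_subspace:
  fixes A :: "real ^ 'n ^ 'n"
  assumes sym: "transpose A = A" and W: "subspace W" and ne: "\<exists>x\<in>W. x \<noteq> 0"
    and inv: "\<And>x. x \<in> W \<Longrightarrow> A *v x \<in> W"
  obtains w c where "w \<in> W" "norm w = 1" "A *v w = c *\<^sub>R w"
proof -
  let ?K = "sphere 0 1 \<inter> W"
  have "compact ?K" by (intro compact_Int_closed compact_sphere closed_subspace W)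
  moreover have "?K \<noteq> {}"
  proof -
    from ne obtain x where x: "x \<in> W" "x \<noteq> 0" by blast
    then have "(1 / norm x) *\<^sub>R x \<in> ?K" using W by (simp add: subspace_scale)
    then show ?thesis by blast
  qed
  moreover have "continuous_on ?K (\<lambda>x. x \<bullet> (A *v x))"
    by (intro continuous_intros linear_continuous_on) (simp add: linear_linear)
  ultimately obtain w where w: "w \<in> ?K" and max: "\<And>y. y \<in> ?K \<Longrightarrow> y \<bullet> (A *v y) \<le> w \<bullet> (A *v w)"
    by (rule continuous_attains_sup[THEN bexE]) blast
  define c where "c = w \<bullet> (A *v w)"
  have wW: "w \<in> W" and w1: "norm w = 1" using w by auto
  \<comment> \<open>The quadratic form of c I - A: maximality makes it nonnegative on
    \<open>W\<close>, and it vanishes at the maximiser \<open>w\<close>.\<close>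
  define q where "q y = c * (y \<bullet> y) - y \<bullet> (A *v y)" for y
  have q_nonneg: "q y \<ge> 0" if y: "y \<in> W" for y
  proof (cases "y = 0")
    case False
    have "(1 / norm y) *\<^sub>R y \<in> ?K" using W False y by (simp add: subspace_scale)
    from max[OF this] have "(y \<bullet> (A *v y)) / (norm y)\<^sup>2 \<le> c"
      by (simp add: c_def matrix_vector_mult_scaleR power2_eq_square)
    then show ?thesis using False by (simp add: q_def field_simps power2_norm_eq_inner)
  qed (simp add: q_def)
  \<comment> \<open>Half the gradient of \<open>q\<close> at its minimum point \<open>w\<close>. As
    \<open>z\<close> lies in \<open>W\<close>, moving along it cannot make \<open>q\<close>
    negative, which will force \<open>z = 0\<close>.\<close>
  define z where "z = c *\<^sub>R w - A *v w"
  have zW: "z \<in> W" unfolding z_def using W wW inv by (simp add: subspace_diff subspace_scale)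
  have expand: "q (w + t *\<^sub>R z) = 2 * t * (z \<bullet> z) + t\<^sup>2 * q z" for t
  proof -
    have "q w = 0" using w1 by (simp add: q_def c_def norm_eq_1)
    moreover have "q (w + t *\<^sub>R z) = q w + 2 * t * (c * (w \<bullet> z) - z \<bullet> (A *v w)) + t\<^sup>2 * q z"
      using inner_matrix_vector_mult_symmetric[OF sym, of w z]
      by (simp add: q_def matrix_vector_right_distrib matrix_vector_mult_scaleR inner_add_left
          inner_add_right inner_commute algebra_simps power2_eq_square)
    moreover have "c * (w \<bullet> z) - z \<bullet> (A *v w) = z \<bullet> z"
      by (simp add: z_def algebra_simps inner_commute)
    ultimately show ?thesis by simp
  qed
  have "z = 0"
  proof (rule ccontr)
    assume "z \<noteq> 0"
    then have zz: "z \<bullet> z > 0" by simp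
    \<comment> \<open>A negative \<open>t\<close> makes the linear term of \<open>expand\<close>
      negative, and this size keeps the quadratic term at most half of it in absolute value. The 1
      in the denominator covers \<open>q z = 0\<close>.\<close>
    define t where "t = - (z \<bullet> z) / (q z + 1)"
    have qz: "q z \<ge> 0" using q_nonneg zW .
    have "0 \<le> q (w + t *\<^sub>R z)"
      by (intro q_nonneg subspace_add subspace_scale W wW zW)
    also have "\<dots> = t * (2 * (z \<bullet> z) + t * q z)"
      by (simp add: expand power2_eq_square algebra_simps)
    also have "\<dots> < 0"
    proof (rule mult_neg_pos)
      show "t < 0" unfolding t_def using zz qz by (simp add: divide_neg_pos)
      have "- t * q z \<le> z \<bullet> z" unfolding t_def using zz qz by (simp add: field_simps)
      then show "0 < 2 * (z \<bullet> z) + t * q z" using zz by linarith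
    qed
    finally show False by simp
  qed
  then have "A *v w = c *\<^sub>R w" by (simp add: z_def)
  with wW w1 show ?thesis by (rule that)
qed

text \<open>A plain set with existential eigenvalues: extension is then inclusion, and a largest
  such set can be chosen by cardinality.\<close>

definition orthonormal_eigenvectors :: "real ^ 'n ^ 'n \<Rightarrow> (real ^ 'n) set \<Rightarrow> bool" where
  "orthonormal_eigenvectors A B \<longleftrightarrow>
     pairwise orthogonal B \<and> (\<forall>b\<in>B. norm b = 1 \<and> (\<exists>c. A *v b = c *\<^sub>R b))"

lemma orthonormal_eigenvectors_independent:
  assumes "orthonormal_eigenvectors A B"
  shows "independent B"
  using assms unfolding orthonormal_eigenvectors_def
  by (intro pairwise_orthogonal_independent) auto

text \<open>Independence bounds the cardinality by the dimension, so a largest extension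
  \<open>B\<close> of \<open>B0\<close> exists. If it did not span, its orthogonal complement would
  supply one more unit eigenvector.\<close>

lemma orthonormal_eigenvectors_extend_basis:
  fixes A :: "real ^ 'n ^ 'n"
  assumes sym: "transpose A = A" and "orthonormal_eigenvectors A B0"
  obtains B where "B0 \<subseteq> B" "orthonormal_eigenvectors A B" "span B = UNIV"
proof -
  let ?Q = "\<lambda>B. B0 \<subseteq> B \<and> orthonormal_eigenvectors A B"
  have bound: "\<forall>B. ?Q B \<longrightarrow> card B < Suc (CARD('n))"
    using independent_bound orthonormal_eigenvectors_independent by (fastforce simp: less_Suc_eq_le)
  obtain B where B: "?Q B" and max: "\<And>B'. ?Q B' \<Longrightarrow> card B' \<le> card B"
    using ex_has_greatest_nat[of ?Q B0 card "Suc (CARD('n))"] assms(2) bound by auto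
  have "finite B" using B orthonormal_eigenvectors_independent independent_bound by blast
  have "span B = UNIV"
  proof (rule ccontr)
    assume "span B \<noteq> UNIV"
    let ?W = "{x. \<forall>b\<in>B. orthogonal b x}"
    have "subspace ?W"
      by (auto simp: subspace_def orthogonal_def inner_add_right)
    moreover have "\<exists>x\<in>?W. x \<noteq> 0"
    proof -
      have "span B \<subset> span UNIV" using \<open>span B \<noteq> UNIV\<close> by auto
      then obtain x where "x \<noteq> 0" "\<And>y. y \<in> span B \<Longrightarrow> orthogonal x y"
        using orthogonal_to_subspace_exists_gen by metis
      then show ?thesis using span_base[of _ B] orthogonal_commute by blast
    qed
    \<comment> \<open>Symmetry moves \<open>A\<close> onto the eigenvector \<open>b\<close>, where
      it only scales, so orthogonality to \<open>b\<close> is preserved.\<close>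
    moreover have "A *v x \<in> ?W" if "x \<in> ?W" for x
      using that B inner_matrix_vector_mult_symmetric[OF sym]
      unfolding orthonormal_eigenvectors_def orthogonal_def by auto
    ultimately obtain w c where w: "w \<in> ?W" "norm w = 1" "A *v w = c *\<^sub>R w"
      using symmetric_matrix_eigenvector_in_subspace[OF sym, of ?W] by blast
    have "w \<notin> B" using w by (auto simp: orthogonal_def norm_eq_1)
    have "?Q (insert w B)"
      using B w by (auto simp: orthonormal_eigenvectors_def pairwise_insert orthogonal_commute)
    then have "card (insert w B) \<le> card B" by (rule max)
    then show False using \<open>w \<notin> B\<close> \<open>finite B\<close> by simp
  qed
  then show ?thesis using B that by blast
qed

text \<open>Indexing by \<open>'n\<close> itself lets the eigenvectors serve as columns of a square
  matrix; \<open>i\<^sub>0\<close> marks \<nu>, so that its eigenvalue can be split off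
  later.\<close>

lemma symmetric_matrix_eigenbasis:
  fixes A :: "real ^ 'n ^ 'n" and \<nu> :: "real ^ 'n"
  assumes sym: "transpose A = A" and \<nu>: "norm \<nu> = 1" "A *v \<nu> = c *\<^sub>R \<nu>"
  obtains f :: "'n \<Rightarrow> real ^ 'n" and d i\<^sub>0
  where "\<And>i j. f i \<bullet> f j = (if i = j then 1 else 0)" "\<And>i. A *v f i = d i *\<^sub>R f i"
    "f i\<^sub>0 = \<nu>" "d i\<^sub>0 = c"
proof -
  have "orthonormal_eigenvectors A {\<nu>}"
    using \<nu> by (auto simp: orthonormal_eigenvectors_def)
  then obtain B where B: "{\<nu>} \<subseteq> B" "orthonormal_eigenvectors A B" "span B = UNIV"
    using orthonormal_eigenvectors_extend_basis[OF sym] by blast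
  have ind: "independent B" using B orthonormal_eigenvectors_independent by blast
  have "card B = CARD('n)"
    using dim_span_eq_card_independent[OF ind] B(3) by simp
  moreover have "finite B" using ind independent_bound by blast
  ultimately obtain f :: "'n \<Rightarrow> real ^ 'n" where f: "bij_betw f UNIV B"
    by (metis finite_same_card_bij finite)
  have fB: "f i \<in> B" for i using f by (auto simp: bij_betw_def)
  have "\<forall>i. \<exists>c. A *v f i = c *\<^sub>R f i" using fB B(2) by (auto simp: orthonormal_eigenvectors_def)
  then obtain d where d: "\<And>i. A *v f i = d i *\<^sub>R f i" by metis
  obtain i\<^sub>0 where i0: "f i\<^sub>0 = \<nu>" using f B(1) unfolding bij_betw_def by (metis insert_subset rangeE)
  have "d i\<^sub>0 *\<^sub>R \<nu> = c *\<^sub>R \<nu>" using d[of i\<^sub>0] i0 \<nu>(2) by metis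
  then have "d i\<^sub>0 = c" using \<nu>(1) by (metis norm_zero scaleR_cancel_right zero_neq_one)
  moreover have "f i \<bullet> f j = (if i = j then 1 else 0)" for i j
  proof (cases "i = j")
    case True
    then show ?thesis using fB B(2) by (auto simp: orthonormal_eigenvectors_def norm_eq_1)
  next
    case False
    then have "f i \<noteq> f j" using f by (auto simp: bij_betw_def inj_def)
    then show ?thesis using fB B(2) False
      by (auto simp: orthonormal_eigenvectors_def pairwise_def orthogonal_def)
  qed
  ultimately show ?thesis using that d i0 by blast
qed

section \<open>Characteristic polynomial of a diagonalized matrix\<close>

lemma map_matrix_const_poly_mult:
  fixes A B :: "'a::comm_ring_1 ^ 'n ^ 'n"
  shows "map_matrix (\<lambda>a. [:a:]) (A ** B) = map_matrix (\<lambda>a. [:a:]) A ** map_matrix (\<lambda>a. [:a:]) B"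
  by (simp add: vec_eq_iff matrix_matrix_mult_def sum_to_poly mult.commute)

lemma matrix_diff_ldistrib:
  fixes A :: "'a::ring_1 ^ 'n ^ 'm"
  shows "A ** (B - C) = A ** B - A ** C"
  by (simp add: vec_eq_iff matrix_matrix_mult_def right_diff_distrib sum_subtractf)

lemma matrix_diff_rdistrib:
  fixes A B :: "'a::ring_1 ^ 'n ^ 'm"
  shows "(A - B) ** C = A ** C - B ** C"
  by (simp add: vec_eq_iff matrix_matrix_mult_def left_diff_distrib sum_subtractf)

text \<open>Lifted to polynomial matrices, \<open>AQ\<close> gives (X I - A) Q = Q (X I - D) with D
  diagonal, since X I commutes with every matrix. Taking determinants, det Q cancels.\<close>

lemma charpoly_orthogonally_diagonalizable:
  fixes A Q :: "real ^ 'n ^ 'n"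
  assumes Q: "orthogonal_matrix Q"
    and AQ: "A ** Q = Q ** (\<chi> i j. if i = j then d j else 0)"
  shows "charpoly A = (\<Prod>i\<in>UNIV. [:- d i, 1:])"
proof -
  let ?h = "map_matrix (\<lambda>a::real. [:a:])"
  let ?D = "\<chi> i j. if i = j then d j else 0"
  let ?X = "mat [:0, 1:] :: real poly ^ 'n ^ 'n"
  have X: "?X ** M = M ** ?X" for M
    by (simp add: vec_eq_iff matrix_matrix_mult_def mat_def if_distrib if_distribR sum.delta
        mult.commute cong: if_cong)
  have "(?X - ?h A) ** ?h Q = ?X ** ?h Q - ?h (A ** Q)"
    by (simp add: matrix_diff_rdistrib map_matrix_const_poly_mult)
  also have "\<dots> = ?h Q ** (?X - ?h ?D)"
    by (simp add: AQ X matrix_diff_ldistrib map_matrix_const_poly_mult)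
  finally have "det ((?X - ?h A) ** ?h Q) = det (?h Q ** (?X - ?h ?D))"
    by (rule arg_cong)
  then have "det (?X - ?h A) * det (?h Q) = det (?h Q) * det (?X - ?h ?D)"
    by (simp only: det_mul)
  \<comment> \<open>The lifted orthogonality relation makes this determinant a unit in the real
    polynomials.\<close>
  moreover have "det (?h Q) \<noteq> 0"
  proof -
    have "?h (transpose Q) ** ?h Q = mat 1"
      using Q unfolding map_matrix_const_poly_mult[symmetric] orthogonal_matrix
      by (simp add: vec_eq_iff mat_def)
    then have "det (?h (transpose Q)) * det (?h Q) = 1" by (metis det_mul det_I)
    then show ?thesis by auto
  qed
  ultimately have "charpoly A = det (?X - ?h ?D)" by (simp add: charpoly_def)
  also have "\<dots> = (\<Prod>i\<in>UNIV. (?X - ?h ?D) $ i $ i)"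
    by (rule det_diagonal) (simp add: mat_def map_matrix_def)
  finally show ?thesis by (simp add: mat_def map_matrix_def)
qed

section \<open>Norm bound on the orthogonal complement of \<nu>\<close>

lemma eigenvalue_list_sorted: "sorted (rev (eigenvalue_list A))"
  by (simp add: eigenvalue_list_def)

text \<open>In the eigenbasis \<open>A\<close> scales each coordinate by its eigenvalue. The
  coordinate of \<open>x\<close> along \<nu> is zero, so only the eigenvalues after the first list
  entry enter.\<close>

lemma symmetric_matrix_norm_le_on_complement:
  fixes A :: "real ^ 'n ^ 'n" and \<nu> :: "real ^ 'n"
  assumes sym: "transpose A = A" and \<nu>: "norm \<nu> = 1" "A *v \<nu> = (eigenvalue_list A ! 0) *\<^sub>R \<nu>"
    and x: "\<nu> \<bullet> x = 0"
  shows "norm (A *v x) \<le>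
    max \<bar>eigenvalue_list A ! 1\<bar> \<bar>eigenvalue_list A ! (CARD('n) - 1)\<bar> * norm x"
    (is "_ \<le> ?m * _")
proof -
  let ?L = "eigenvalue_list A"
  obtain f :: "'n \<Rightarrow> real ^ 'n" and d i\<^sub>0
    where f: "\<And>i j. f i \<bullet> f j = (if i = j then 1 else 0)" and d: "\<And>i. A *v f i = d i *\<^sub>R f i"
      and i0: "f i\<^sub>0 = \<nu>" "d i\<^sub>0 = ?L ! 0"
    using symmetric_matrix_eigenbasis[OF sym \<nu>] by blast
  define Q where "Q = (\<chi> i j. f j $ i)"
  have Q: "orthogonal_matrix Q"
    using f unfolding orthogonal_matrix Q_def
    by (simp add: vec_eq_iff matrix_matrix_mult_def transpose_def mat_def inner_vec_def)
  have "A ** Q = Q ** (\<chi> i j. if i = j then d j else 0)"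
    using d by (simp add: vec_eq_iff Q_def matrix_matrix_mult_def matrix_vector_mult_def
        if_distrib if_distribR sum.delta mult.commute cong: if_cong)
  then have "charpoly A = (\<Prod>i\<in>UNIV. [:- d i, 1:])"
    by (rule charpoly_orthogonally_diagonalizable[OF Q])
  then have "proots (charpoly A) = (\<Sum>i\<in>UNIV. proots [:- d i, 1:])"
    by (simp add: proots_prod)
  also have "\<dots> = image_mset d (mset_set UNIV)"
    by (simp add: sum_unfold_sum_mset)
  finally have L: "mset ?L = image_mset d (mset_set UNIV)" by (simp add: eigenvalue_list_def)
  then have len: "length ?L = CARD('n)" by (metis size_mset size_image_mset size_mset_set)
  have d_le: "\<bar>d j\<bar> \<le> ?m" if j: "j \<noteq> i\<^sub>0" for j
  proof -
    have "?L \<noteq> []" using len by auto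
    then have Lc: "?L = ?L ! 0 # tl ?L" by (cases ?L) auto
    \<comment> \<open>Exactly one copy of \<open>?L ! 0\<close> is cancelled: with multiplicity it
      may occur again among the remaining \<open>d j\<close>, hence multisets rather than
      sets.\<close>
    have "mset_set UNIV = add_mset i\<^sub>0 (mset_set (UNIV - {i\<^sub>0}))"
      by (simp add: mset_set.remove)
    then have "add_mset (?L ! 0) (mset (tl ?L)) = add_mset (?L ! 0) (image_mset d (mset_set (UNIV - {i\<^sub>0})))"
      using L i0(2) by (metis Lc image_mset_add_mset mset.simps(2))
    then have "set (tl ?L) = d ` (UNIV - {i\<^sub>0})"
      by (metis add_left_imp_eq add_mset_add_single finite finite_set_mset_mset_set
          set_image_mset set_mset_mset union_commute)
    then have "d j \<in> set (tl ?L)" using j by auto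
    then obtain k where k: "k < length (tl ?L)" "tl ?L ! k = d j" by (auto simp: in_set_conv_nth)
    \<comment> \<open>Position \<open>k\<close> of the tail is position \<open>Suc k\<close> of the
      list, so \<open>d j\<close> lies between the second and the last entry. In particular
      \<open>?L ! 1\<close> is a genuine entry here.\<close>
    then have k': "Suc k < CARD('n)" "?L ! Suc k = d j" using len by (auto simp: nth_tl)
    have "d j \<le> ?L ! 1"
      using sorted_rev_nth_mono[OF eigenvalue_list_sorted, of 1 "Suc k" A] k' len by simp
    moreover have "?L ! (CARD('n) - 1) \<le> d j"
      using sorted_rev_nth_mono[OF eigenvalue_list_sorted, of "Suc k" "CARD('n) - 1" A] k' len by simp
    ultimately show ?thesis by auto
  qed
  \<comment> \<open>Passing to eigenbasis coordinates is an isometry, so norms can be compared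
    coordinate by coordinate.\<close>
  define P where "P = transpose Q"
  have coord: "(P *v y) $ i = f i \<bullet> y" for i y
    by (simp add: P_def Q_def transpose_def matrix_vector_mult_def inner_vec_def)
  have iso: "norm (P *v y) = norm y" for y
    using Q unfolding P_def by (intro orthogonal_transformation_norm) (simp add: orthogonal_transformation_matrix del: transpose_matrix_vector)
  have "\<bar>(P *v (A *v x)) $ i\<bar> \<le> \<bar>(?m *\<^sub>R (P *v x)) $ i\<bar>" for i
  proof (cases "i = i\<^sub>0")
    case True
    then have "f i \<bullet> x = 0" using x i0 by simp
    then show ?thesis by (simp add: coord inner_matrix_vector_mult_symmetric[OF sym] d)
  next
    case False
    then show ?thesis using d_le[OF False]
      by (simp add: coord inner_matrix_vector_mult_symmetric[OF sym] d abs_mult mult_right_mono)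
  qed
  then have "norm (P *v (A *v x)) \<le> norm (?m *\<^sub>R (P *v x))"
    by (intro norm_le_componentwise_cart) simp
  then show ?thesis by (simp add: iso)
qed

section \<open>Application to the adjacency matrix\<close>

lemma transpose_adj_matrix: "transpose (adj_matrix E) = adj_matrix E"
  by (simp add: transpose_def adj_matrix_def vec_eq_iff insert_commute)

lemma inner_char_vec_self: "char_vec S \<bullet> char_vec S = real (card S)"
  by (simp add: inner_vec_def char_vec_def if_distrib sum.If_cases cong: if_cong)

text \<open>Pythagoras; with characteristic vectors it produces the two factors under the square
  root.\<close>

lemma norm_diff_projection:
  fixes x u :: "'a::real_inner"
  assumes "norm u = 1"
  shows "(norm (x - (x \<bullet> u) *\<^sub>R u))\<^sup>2 = x \<bullet> x - (x \<bullet> u)\<^sup>2"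
  using assms unfolding power2_norm_eq_inner
  by (simp add: inner_diff_left inner_diff_right inner_commute norm_eq_1 power2_eq_square)

theorem theorem11:
  fixes E :: "'v::finite set set" and \<nu> :: "real ^ 'v" and \<mu> :: real and S T :: "'v set"
  assumes "simple_graph E"
    and "connected_graph E"
    and "CARD('v) \<ge> 2"
    and "normalized_perron_vector E \<nu>"
    and "\<mu> = max \<bar>adj_eigenvalue E 2\<bar> \<bar>adj_eigenvalue E CARD('v)\<bar>"
  shows "\<bar>real (edges_between E S T)
            - adj_eigenvalue E 1 * (char_vec S \<bullet> \<nu>) * (char_vec T \<bullet> \<nu>)\<bar>
         \<le> \<mu> * sqrt ((real (card S) - (char_vec S \<bullet> \<nu>)\<^sup>2) * (real (card T) - (char_vec T \<bullet> \<nu>)\<^sup>2))"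
proof -
  let ?A = "adj_matrix E"
  let ?c = "adj_eigenvalue E 1"
  have sym: "\<nu> \<bullet> (?A *v u) = (?A *v \<nu>) \<bullet> u" for u
    by (rule inner_matrix_vector_mult_symmetric[OF transpose_adj_matrix])
  have \<nu>: "norm \<nu> = 1" "?A *v \<nu> = ?c *\<^sub>R \<nu>"
    using assms(4) by (auto simp: normalized_perron_vector_def)
  define x where "x = char_vec S - (char_vec S \<bullet> \<nu>) *\<^sub>R \<nu>"
  define y where "y = char_vec T - (char_vec T \<bullet> \<nu>) *\<^sub>R \<nu>"
  have \<nu>\<nu>: "\<nu> \<bullet> \<nu> = 1" using \<nu>(1) by (simp add: norm_eq_1)
  have x_orth: "x \<bullet> \<nu> = 0" by (simp add: x_def inner_diff_left \<nu>\<nu>)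
  have y_orth: "\<nu> \<bullet> y = 0" by (simp add: y_def inner_diff_right \<nu>\<nu> inner_commute)
  \<comment> \<open>Replacing \<open>y\<close> by \<open>char_vec T\<close> changes the image under
    the matrix by a multiple of \<nu>, which is orthogonal to \<open>x\<close>.\<close>
  have "x \<bullet> (?A *v y) = x \<bullet> (?A *v char_vec T)"
    by (simp add: y_def matrix_vector_mult_diff_distrib matrix_vector_mult_scaleR \<nu>(2)
        inner_diff_right x_orth)
  also have "\<dots> = char_vec S \<bullet> (?A *v char_vec T) - (char_vec S \<bullet> \<nu>) * ((?A *v \<nu>) \<bullet> char_vec T)"
    by (simp add: x_def inner_diff_left sym)
  also have "\<dots> = real (edges_between E S T) - ?c * (char_vec S \<bullet> \<nu>) * (char_vec T \<bullet> \<nu>)"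
    by (simp add: edges_between_eq_inner[OF assms(1)] \<nu>(2) inner_commute)
  finally have "\<bar>real (edges_between E S T) - ?c * (char_vec S \<bullet> \<nu>) * (char_vec T \<bullet> \<nu>)\<bar>
      = \<bar>x \<bullet> (?A *v y)\<bar>" by simp
  also have "\<dots> \<le> norm x * norm (?A *v y)" by (rule Cauchy_Schwarz_ineq2)
  \<comment> \<open>Eigenvalue numbers 1, 2 and n are list positions 0, 1 and n - 1, which matches
    the norm bound.\<close>
  also have "\<dots> \<le> norm x * (\<mu> * norm y)"
    using symmetric_matrix_norm_le_on_complement[OF transpose_adj_matrix \<nu>(1) _ y_orth] \<nu>(2) assms(5)
    by (intro mult_left_mono) (auto simp: adj_eigenvalue_def)
  also have "\<dots> = \<mu> * sqrt ((norm x)\<^sup>2 * (norm y)\<^sup>2)"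
    by (simp add: real_sqrt_mult)
  also have "(norm x)\<^sup>2 = real (card S) - (char_vec S \<bullet> \<nu>)\<^sup>2"
    unfolding x_def by (simp add: norm_diff_projection[OF \<nu>(1)] inner_char_vec_self)
  also have "(norm y)\<^sup>2 = real (card T) - (char_vec T \<bullet> \<nu>)\<^sup>2"
    unfolding y_def by (simp add: norm_diff_projection[OF \<nu>(1)] inner_char_vec_self)
  finally show ?thesis .
qed

end
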